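(* Let $\mathbb K\in\{\mathbb R,\mathbb C,\mathbb H,\mathbb O\}$ be a real normed division algebra. Let $H$ be a $\mathbb K$-Hilbert space with $\mathbb K$-inner product $\langle\cdot,\cdot\rangle$, and let $H^*$ be its dual, consisting of all continuous $\mathbb K$-para-linear functionals $H\to\mathbb K$. Then $H$ and $(H^* )^-$ can be identified up to isomorphism of $\mathbb K$-Hilbert spaces. Precisely: the map $\tau: H\to (H^* )^-$, $\tau(y)=\langle\cdot,y\rangle$, is a well-defined bijective isomorphism of left $\mathbb K$-modules, and when $(H^* )^-$ is given the inner product $\langle f,g\rangle:=\langle\tau^{-1}(f),\tau^{-1}(g)\rangle$, it is a $\mathbb K$-Hilbert space and $\tau$ is an isomorphism of $\mathbb K$-Hilbert spaces.
   Context: $\mathbb H$ denotes the quaternions and $\mathbb O$ the octonions; bar denotes conjugation and $\mathrm{Re}$ the real part in $\mathbb K$. Left $\mathbb K$-module: a real vector space $M$ with an $\mathbb R$-bilinear scalar multiplication $\mathbb K\times M\to M$, $1m=m$, which for $\mathbb K=\mathbb R,\mathbb C,\mathbb H$ is associative ($(pq)m=p(qm)$), and for $\mathbb K=\mathbb O$ satisfies $r(rm)=r^2m$ for all $r\in\mathbb O$, $m\in M$ (equivalently, $[p,q,m]:=(pq)m-p(qm)$ satisfies $[p,q,m]=-[q,p,m]$). Right $\mathbb K$-modules are defined symmetrically (for $\mathbb O$: $(mr)r=mr^2$). For a real linear map $f:M\to\mathbb K$ on a left $\mathbb K$-module, put $[p,x,f]:=f(px)-pf(x)$ for $p\in\mathbb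 K$, $x\in M$. The map $f$ is (left) $\mathbb K$-para-linear if $\mathrm{Re}\,[p,x,f]=0$ for all $p\in\mathbb K$, $x\in M$. $\mathbb K$-Hilbert space: a real Hilbert space $H$ with real inner product $\langle\cdot,\cdot\rangle_{\mathbb R}$ that is also a left $\mathbb K$-module and carries an $\mathbb R$-bilinear map $\langle\cdot,\cdot\rangle:H\times H\to\mathbb K$ (the $\mathbb K$-inner product) with $\mathrm{Re}\,\langle\cdot,\cdot\rangle=\langle\cdot,\cdot\rangle_{\mathbb R}$ such that: (1) $\langle\cdot,u\rangle$ is left $\mathbb K$-para-linear for all $u\in H$; (2) $\langle u,v\rangle=\overline{\langle v,u\rangle}$ for all $u,v\in H$; (3) $\langle u,u\rangle$ is a nonnegative real number for all $u$, and is $0$ if and only if $u=0$. An isomorphism of $\mathbb K$-Hilbert spaces is a bijective left $\mathbb K$-module isomorphism preserving the $\mathbb K$-inner product. $H^*$ is a right $\mathbb K$-module under pointwise addition and the multiplication $(f\odot p)(x):=f(x)p-[p,x,f]$. For a right $\mathbb K$-module $M$, $M^-$ denotes the same real vector space $M$ made into a left $\mathbb K$-module by $p\cdot x:=x\overline p$; thus in $(H^* )^-$ one has $p\cdot f=f\odot\overline p$. *)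

theory Defs
  imports "HOL-Analysis.Analysis" "HOL-Library.Function_Algebras"
begin

section \<open>The algebras \<open>\<real>\<close>, \<open>\<complex>\<close>, \<open>\<H>\<close>, \<open>\<O>\<close>\<close>

text \<open>
  A purely syntactic class: it collects the operations that the four algebras share, without
  axioms. Multiplication is neither assumed associative nor commutative, so the ring classes of
  the library do not apply to the octonions.
\<close>

class conj_algebra = real_normed_vector + one + times +
  fixes kconj :: "'a \<Rightarrow> 'a"
    and kre :: "'a \<Rightarrow> real"

instantiation real :: conj_algebra
begin
definition kconj_real :: "real \<Rightarrow> real" where "kconj_real x = x"
definition kre_real :: "real \<Rightarrow> real" where "kre_real x = x"
instance ..
end

instantiation complex :: conj_algebra
begin
definition kconj_complex :: "complex \<Rightarrow> complex" where "kconj_complex z = cnj z"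
definition kre_complex :: "complex \<Rightarrow> real" where "kre_complex z = Re z"
instance ..
end

datatype quat = Quat (qre: real) (qi: real) (qj: real) (qk: real)

instantiation quat :: real_vector
begin
definition "0 = Quat 0 0 0 0"
definition "x + y = Quat (qre x + qre y) (qi x + qi y) (qj x + qj y) (qk x + qk y)"
definition "x - y = Quat (qre x - qre y) (qi x - qi y) (qj x - qj y) (qk x - qk y)"
definition "- x = Quat (- qre x) (- qi x) (- qj x) (- qk x)"
definition "c *\<^sub>R x = Quat (c * qre x) (c * qi x) (c * qj x) (c * qk x)"
instance
  by standard
    (simp_all add: zero_quat_def plus_quat_def minus_quat_def uminus_quat_def scaleR_quat_def
      algebra_simps)
end

instantiation quat :: real_normed_vector
begin
definition norm_quat :: "quat \<Rightarrow> real" where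
  "norm x = sqrt ((qre x)\<^sup>2 + (qi x)\<^sup>2 + (qj x)\<^sup>2 + (qk x)\<^sup>2)"
definition "sgn (x::quat) = x /\<^sub>R norm x"
definition "dist (x::quat) y = norm (x - y)"
definition [code del]:
  "(uniformity :: (quat \<times> quat) filter) = (INF e\<in>{0<..}. principal {(x, y). dist x y < e})"
definition [code del]:
  "open (U :: quat set) \<longleftrightarrow> (\<forall>x\<in>U. eventually (\<lambda>(x', y). x' = x \<longrightarrow> y \<in> U) uniformity)"
instance
proof
  fix x y :: quat and a :: real
  have norm_eq: "norm z = norm ((qre z, qi z), (qj z, qk z))" for z :: quat
    by (simp add: norm_quat_def norm_Pair algebra_simps)
  show "norm x = 0 \<longleftrightarrow> x = 0"
    unfolding norm_eq by (cases x) (simp add: zero_quat_def zero_prod_def)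
  show "norm (x + y) \<le> norm x + norm y"
    unfolding norm_eq
    using norm_triangle_ineq[of "((qre x, qi x), (qj x, qk x))" "((qre y, qi y), (qj y, qk y))"]
    by (simp add: plus_quat_def)
  show "norm (a *\<^sub>R x) = \<bar>a\<bar> * norm x"
    unfolding norm_eq
    using norm_scaleR[of a "((qre x, qi x), (qj x, qk x))"]
    by (simp add: scaleR_quat_def)
qed (rule sgn_quat_def dist_quat_def uniformity_quat_def open_quat_def)+
end

instantiation quat :: conj_algebra
begin
definition "1 = Quat 1 0 0 0"
definition "x * y = Quat
   (qre x * qre y - qi x * qi y - qj x * qj y - qk x * qk y)
   (qre x * qi y + qi x * qre y + qj x * qk y - qk x * qj y)
   (qre x * qj y - qi x * qk y + qj x * qre y + qk x * qi y)
   (qre x * qk y + qi x * qj y - qj x * qi y + qk x * qre y)"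
definition kconj_quat :: "quat \<Rightarrow> quat" where
  "kconj_quat x = Quat (qre x) (- qi x) (- qj x) (- qk x)"
definition kre_quat :: "quat \<Rightarrow> real" where "kre_quat = qre"
instance ..
end

text \<open>The octonions are obtained from the quaternions by the Cayley--Dickson doubling.\<close>

datatype oct = Oct (ofst: quat) (osnd: quat)

instantiation oct :: real_vector
begin
definition "0 = Oct 0 0"
definition "x + y = Oct (ofst x + ofst y) (osnd x + osnd y)"
definition "x - y = Oct (ofst x - ofst y) (osnd x - osnd y)"
definition "- x = Oct (- ofst x) (- osnd x)"
definition "c *\<^sub>R x = Oct (c *\<^sub>R ofst x) (c *\<^sub>R osnd x)"
instance
  by standard
    (simp_all add: zero_oct_def plus_oct_def minus_oct_def uminus_oct_def scaleR_oct_def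
      algebra_simps)
end

instantiation oct :: real_normed_vector
begin
definition norm_oct :: "oct \<Rightarrow> real" where
  "norm x = sqrt ((norm (ofst x))\<^sup>2 + (norm (osnd x))\<^sup>2)"
definition "sgn (x::oct) = x /\<^sub>R norm x"
definition "dist (x::oct) y = norm (x - y)"
definition [code del]:
  "(uniformity :: (oct \<times> oct) filter) = (INF e\<in>{0<..}. principal {(x, y). dist x y < e})"
definition [code del]:
  "open (U :: oct set) \<longleftrightarrow> (\<forall>x\<in>U. eventually (\<lambda>(x', y). x' = x \<longrightarrow> y \<in> U) uniformity)"
instance
proof
  fix x y :: oct and a :: real
  have norm_eq: "norm z = norm (ofst z, osnd z)" for z :: oct
    by (simp add: norm_oct_def norm_Pair)
  show "norm x = 0 \<longleftrightarrow> x = 0"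
    unfolding norm_eq by (cases x) (simp add: zero_oct_def zero_prod_def)
  show "norm (x + y) \<le> norm x + norm y"
    unfolding norm_eq
    using norm_triangle_ineq[of "(ofst x, osnd x)" "(ofst y, osnd y)"]
    by (simp add: plus_oct_def)
  show "norm (a *\<^sub>R x) = \<bar>a\<bar> * norm x"
    unfolding norm_eq
    using norm_scaleR[of a "(ofst x, osnd x)"]
    by (simp add: scaleR_oct_def)
qed (rule sgn_oct_def dist_oct_def uniformity_oct_def open_oct_def)+
end

instantiation oct :: conj_algebra
begin
definition "1 = Oct 1 0"
definition "x * y = Oct
   (ofst x * ofst y - kconj (osnd y) * osnd x)
   (osnd y * ofst x + osnd x * kconj (ofst y))"
definition kconj_oct :: "oct \<Rightarrow> oct" where "kconj_oct x = Oct (kconj (ofst x)) (- osnd x)"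
definition kre_oct :: "oct \<Rightarrow> real" where "kre_oct x = kre (ofst x)"
instance ..
end

definition conj_algebra_iso :: "('a::conj_algebra \<Rightarrow> 'b::conj_algebra) \<Rightarrow> bool" where
  "conj_algebra_iso \<phi> \<longleftrightarrow> linear \<phi> \<and> bij \<phi> \<and> \<phi> 1 = 1 \<and> (\<forall>x y. \<phi> (x * y) = \<phi> x * \<phi> y) \<and>
     (\<forall>x. norm (\<phi> x) = norm x) \<and> (\<forall>x. \<phi> (kconj x) = kconj (\<phi> x)) \<and> (\<forall>x. kre (\<phi> x) = kre x)"

definition is_octonions :: "'k::conj_algebra itself \<Rightarrow> bool" where
  "is_octonions (_ :: 'k itself) \<longleftrightarrow> (\<exists>\<phi> :: 'k \<Rightarrow> oct. conj_algebra_iso \<phi>)"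

text \<open>
  A type cannot be quantified over inside a formula, so \<open>\<K> \<in> {\<real>, \<complex>, \<H>, \<O>}\<close> is a condition on a
  type variable. The four lemmas below show that it covers the four algebras themselves.
\<close>

definition is_RCHO :: "'k::conj_algebra itself \<Rightarrow> bool" where
  "is_RCHO (_ :: 'k itself) \<longleftrightarrow>
     (\<exists>\<phi> :: 'k \<Rightarrow> real. conj_algebra_iso \<phi>) \<or>
     (\<exists>\<phi> :: 'k \<Rightarrow> complex. conj_algebra_iso \<phi>) \<or>
     (\<exists>\<phi> :: 'k \<Rightarrow> quat. conj_algebra_iso \<phi>) \<or>
     is_octonions TYPE('k)"

lemma conj_algebra_iso_id: "conj_algebra_iso (\<lambda>x. x)"
  by (simp add: conj_algebra_iso_def linear_iff bij_def)

lemma is_RCHO_real: "is_RCHO TYPE(real)"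
  using conj_algebra_iso_id is_RCHO_def by blast

lemma is_RCHO_complex: "is_RCHO TYPE(complex)"
  using conj_algebra_iso_id is_RCHO_def by blast

lemma is_RCHO_quat: "is_RCHO TYPE(quat)"
  using conj_algebra_iso_id is_RCHO_def by blast

lemma is_octonions_oct: "is_octonions TYPE(oct)"
  using conj_algebra_iso_id is_octonions_def by blast

lemma is_RCHO_oct: "is_RCHO TYPE(oct)"
  using is_octonions_oct by (simp add: is_RCHO_def)


section \<open>Modules\<close>

text \<open>
  The dual space is a set of functions, so real vector spaces are subspaces \<open>S\<close> of a type of class
  \<^class>\<open>real_vector\<close>; this instance supplies the pointwise structure on functions.
\<close>

instantiation "fun" :: (type, real_vector) real_vector
begin
definition scaleR_fun :: "real \<Rightarrow> ('a \<Rightarrow> 'b) \<Rightarrow> 'a \<Rightarrow> 'b" where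
  "c *\<^sub>R f = (\<lambda>x. c *\<^sub>R f x)"
instance
  by standard (simp_all add: scaleR_fun_def fun_eq_iff algebra_simps)
end

definition real_linear_on :: "'a::real_vector set \<Rightarrow> ('a \<Rightarrow> 'b::real_vector) \<Rightarrow> bool" where
  "real_linear_on S f \<longleftrightarrow>
     (\<forall>x\<in>S. \<forall>y\<in>S. f (x + y) = f x + f y) \<and> (\<forall>c. \<forall>x\<in>S. f (c *\<^sub>R x) = c *\<^sub>R f x)"

definition real_bilinear_on ::
  "'a::real_vector set \<Rightarrow> 'b::real_vector set \<Rightarrow> ('a \<Rightarrow> 'b \<Rightarrow> 'c::real_vector) \<Rightarrow> bool" where
  "real_bilinear_on S T b \<longleftrightarrow>
     (\<forall>x\<in>S. real_linear_on T (b x)) \<and> (\<forall>y\<in>T. real_linear_on S (\<lambda>x. b x y))"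

definition left_module :: "'m::real_vector set \<Rightarrow> ('k::conj_algebra \<Rightarrow> 'm \<Rightarrow> 'm) \<Rightarrow> bool" where
  "left_module S sm \<longleftrightarrow> subspace S \<and> (\<forall>p. \<forall>x\<in>S. sm p x \<in> S) \<and>
     real_bilinear_on UNIV S sm \<and> (\<forall>x\<in>S. sm 1 x = x) \<and>
     (if is_octonions TYPE('k)
      then \<forall>r. \<forall>x\<in>S. sm r (sm r x) = sm (r * r) x
      else \<forall>p q. \<forall>x\<in>S. sm (p * q) x = sm p (sm q x))"

definition right_module :: "'m::real_vector set \<Rightarrow> ('m \<Rightarrow> 'k::conj_algebra \<Rightarrow> 'm) \<Rightarrow> bool" where
  "right_module S rm \<longleftrightarrow> subspace S \<and> (\<forall>p. \<forall>x\<in>S. rm x p \<in> S) \<and>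
     real_bilinear_on S UNIV rm \<and> (\<forall>x\<in>S. rm x 1 = x) \<and>
     (if is_octonions TYPE('k)
      then \<forall>r. \<forall>x\<in>S. rm (rm x r) r = rm x (r * r)
      else \<forall>p q. \<forall>x\<in>S. rm x (p * q) = rm (rm x p) q)"

text \<open>The scalar multiplication of \<open>M\<^sup>-\<close>, for a right module \<open>M\<close>.\<close>

definition opp_smult :: "('m \<Rightarrow> 'k::conj_algebra \<Rightarrow> 'm) \<Rightarrow> 'k \<Rightarrow> 'm \<Rightarrow> 'm" where
  "opp_smult rm p x = rm x (kconj p)"

definition left_module_iso ::
  "'m::real_vector set \<Rightarrow> ('k::conj_algebra \<Rightarrow> 'm \<Rightarrow> 'm) \<Rightarrow>
   'n::real_vector set \<Rightarrow> ('k \<Rightarrow> 'n \<Rightarrow> 'n) \<Rightarrow> ('m \<Rightarrow> 'n) \<Rightarrow> bool" where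
  "left_module_iso S sm T tm \<phi> \<longleftrightarrow> left_module S sm \<and> left_module T tm \<and>
     real_linear_on S \<phi> \<and> bij_betw \<phi> S T \<and> (\<forall>p. \<forall>x\<in>S. \<phi> (sm p x) = tm p (\<phi> x))"

text \<open>The associator \<open>[p, x, f]\<close>.\<close>

definition map_assoc ::
  "('k::conj_algebra \<Rightarrow> 'm \<Rightarrow> 'm) \<Rightarrow> 'k \<Rightarrow> 'm \<Rightarrow> ('m \<Rightarrow> 'k) \<Rightarrow> 'k" where
  "map_assoc sm p x f = f (sm p x) - p * f x"

definition para_linear_on ::
  "'m::real_vector set \<Rightarrow> ('k::conj_algebra \<Rightarrow> 'm \<Rightarrow> 'm) \<Rightarrow> ('m \<Rightarrow> 'k) \<Rightarrow> bool" where
  "para_linear_on S sm f \<longleftrightarrow>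
     real_linear_on S f \<and> (\<forall>p. \<forall>x\<in>S. kre (map_assoc sm p x f) = 0)"


section \<open>Hilbert spaces over \<open>\<K>\<close>\<close>

definition real_Hilbert_on :: "'m::real_vector set \<Rightarrow> ('m \<Rightarrow> 'm \<Rightarrow> real) \<Rightarrow> bool" where
  "real_Hilbert_on S rip \<longleftrightarrow> subspace S \<and> real_bilinear_on S S rip \<and>
     (\<forall>x\<in>S. \<forall>y\<in>S. rip x y = rip y x) \<and>
     (\<forall>x\<in>S. 0 \<le> rip x x) \<and> (\<forall>x\<in>S. rip x x = 0 \<longleftrightarrow> x = 0) \<and>
     (\<forall>u :: nat \<Rightarrow> 'm. (\<forall>n. u n \<in> S) \<longrightarrow>
        (\<forall>e>0. \<exists>N. \<forall>m\<ge>N. \<forall>n\<ge>N. sqrt (rip (u m - u n) (u m - u n)) < e) \<longrightarrow>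
        (\<exists>l\<in>S. (\<lambda>n. sqrt (rip (u n - l) (u n - l))) \<longlonglongrightarrow> 0))"

text \<open>\<open>rip\<close> is the real inner product, \<open>ip\<close> the \<open>\<K>\<close>-valued one.\<close>

definition K_Hilbert_on ::
  "'m::real_vector set \<Rightarrow> ('m \<Rightarrow> 'm \<Rightarrow> real) \<Rightarrow> ('k::conj_algebra \<Rightarrow> 'm \<Rightarrow> 'm) \<Rightarrow>
   ('m \<Rightarrow> 'm \<Rightarrow> 'k) \<Rightarrow> bool" where
  "K_Hilbert_on S rip sm ip \<longleftrightarrow> real_Hilbert_on S rip \<and> left_module S sm \<and>
     real_bilinear_on S S ip \<and> (\<forall>x\<in>S. \<forall>y\<in>S. kre (ip x y) = rip x y) \<and>
     (\<forall>u\<in>S. para_linear_on S sm (\<lambda>x. ip x u)) \<and>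
     (\<forall>u\<in>S. \<forall>v\<in>S. ip u v = kconj (ip v u)) \<and>
     (\<forall>u\<in>S. (\<exists>r\<ge>0. ip u u = r *\<^sub>R 1) \<and> (ip u u = 0 \<longleftrightarrow> u = 0))"

definition K_Hilbert_iso ::
  "'m::real_vector set \<Rightarrow> ('m \<Rightarrow> 'm \<Rightarrow> real) \<Rightarrow> ('k::conj_algebra \<Rightarrow> 'm \<Rightarrow> 'm) \<Rightarrow>
   ('m \<Rightarrow> 'm \<Rightarrow> 'k) \<Rightarrow>
   'n::real_vector set \<Rightarrow> ('n \<Rightarrow> 'n \<Rightarrow> real) \<Rightarrow> ('k \<Rightarrow> 'n \<Rightarrow> 'n) \<Rightarrow> ('n \<Rightarrow> 'n \<Rightarrow> 'k) \<Rightarrow>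
   ('m \<Rightarrow> 'n) \<Rightarrow> bool" where
  "K_Hilbert_iso S rip sm ip T rip' tm ip' \<phi> \<longleftrightarrow>
     K_Hilbert_on S rip sm ip \<and> K_Hilbert_on T rip' tm ip' \<and>
     left_module_iso S sm T tm \<phi> \<and> (\<forall>x\<in>S. \<forall>y\<in>S. ip' (\<phi> x) (\<phi> y) = ip x y)"

definition dual_space ::
  "('k::conj_algebra \<Rightarrow> 'h::real_normed_vector \<Rightarrow> 'h) \<Rightarrow> ('h \<Rightarrow> 'k) set" where
  "dual_space sm = {f. para_linear_on UNIV sm f \<and> continuous_on UNIV f}"

definition dual_rmult ::
  "('k::conj_algebra \<Rightarrow> 'h \<Rightarrow> 'h) \<Rightarrow> ('h \<Rightarrow> 'k) \<Rightarrow> 'k \<Rightarrow> ('h \<Rightarrow> 'k)" where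
  "dual_rmult sm f p = (\<lambda>x. f x * p - map_assoc sm p x f)"

end

theory Submission
  imports Defs
begin

text \<open>
  A para-linear \<open>f\<close> satisfies \<open>Re (p f(x)) = Re f(px)\<close>, so it is determined by
  \<open>Re f\<close>, and every identity in \<open>H\<^sup>*\<close> can be checked on real parts, where
  \<open>Re (f \<odot> p)(x) = Re f(px)\<close>. The non-associativity of \<open>\<K>\<close> disappears there, because
  \<open>Re (ab) = Re (ba)\<close> and \<open>Re ((ab)c) = Re (a(bc))\<close> hold even in \<open>\<O>\<close>; these trace identities, together
  with \<open>kconj a = 2 Re a - a\<close> and \<open>kconj a \<cdot> a = \<bar>a\<bar>\<^sup>2\<close>, are all that is used of \<open>\<K>\<close>. Left
  alternativity of \<open>H\<close> makes \<open>f \<odot> p\<close> para-linear and gives \<open>\<parallel>px\<parallel> = \<bar>p\<bar> \<parallel>x\<parallel>\<close>, hence continuity.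
  Surjectivity of \<open>\<tau>\<close> is the real Riesz representation theorem applied to \<open>Re f\<close>.
\<close>

section \<open>Trace identities common to the four algebras\<close>

text \<open>Every axiom is an identity invariant under \<open>conj_algebra_iso\<close>: it can be
  verified in coordinates for each model and then pulled back to \<open>'k\<close>.\<close>

locale normed_conj_algebra =
  fixes K :: "'k::conj_algebra itself"
  assumes bilinear_mult: "bilinear ((*) :: 'k \<Rightarrow> 'k \<Rightarrow> 'k)"
    and linear_kre: "linear (kre :: 'k \<Rightarrow> real)"
    and one_mult [simp]: "1 * (a :: 'k) = a"
    and mult_one [simp]: "(a :: 'k) * 1 = a"
    and kre_one [simp]: "kre (1 :: 'k) = 1"
    and kre_mult_commute: "kre ((a :: 'k) * b) = kre (b * a)"
    and kre_mult_assoc: "kre ((a :: 'k) * b * c) = kre (a * (b * c))"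
    and kconj_eq: "kconj (a :: 'k) = (2 * kre a) *\<^sub>R 1 - a"
    and kconj_mult_self: "kconj (a :: 'k) * a = (norm a)\<^sup>2 *\<^sub>R 1"

lemma normed_conj_algebra_real: "normed_conj_algebra TYPE(real)"
  by standard
    (auto simp: kre_real_def kconj_real_def bilinear_def linear_iff algebra_simps power2_eq_square)

lemma normed_conj_algebra_complex: "normed_conj_algebra TYPE(complex)"
  by standard
    (auto simp: kre_complex_def kconj_complex_def bilinear_def linear_iff algebra_simps
      complex_eq_iff cmod_power2[unfolded power2_eq_square] power2_eq_square)

lemmas quat_defs = zero_quat_def plus_quat_def minus_quat_def uminus_quat_def scaleR_quat_def
  one_quat_def times_quat_def kconj_quat_def kre_quat_def

lemmas oct_defs = zero_oct_def plus_oct_def minus_oct_def uminus_oct_def scaleR_oct_def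
  one_oct_def times_oct_def kconj_oct_def kre_oct_def

lemma norm_quat_power2: "(norm (x :: quat))\<^sup>2 = (qre x)\<^sup>2 + (qi x)\<^sup>2 + (qj x)\<^sup>2 + (qk x)\<^sup>2"
  by (simp add: norm_quat_def)

lemma norm_oct_power2: "(norm (x :: oct))\<^sup>2 = (norm (ofst x))\<^sup>2 + (norm (osnd x))\<^sup>2"
  by (simp add: norm_oct_def)

lemma normed_conj_algebra_quat: "normed_conj_algebra TYPE(quat)"
  by standard
    (auto simp: bilinear_def linear_iff quat_defs norm_quat_power2[unfolded power2_eq_square]
      algebra_simps power2_eq_square)

lemma normed_conj_algebra_oct: "normed_conj_algebra TYPE(oct)"
  by standard
    (auto simp: bilinear_def linear_iff oct_defs quat_defs norm_oct_power2[unfolded power2_eq_square]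
      norm_quat_power2[unfolded power2_eq_square] algebra_simps power2_eq_square)

text \<open>\<open>is_RCHO\<close> fixes the algebra only up to isomorphism. Since \<phi> is
  injective, an identity in \<open>'k\<close> holds as soon as its image in \<open>'l\<close>
  does.\<close>

lemma normed_conj_algebra_iso:
  fixes \<phi> :: "'k::conj_algebra \<Rightarrow> 'l::conj_algebra"
  assumes iso: "conj_algebra_iso \<phi>" and "normed_conj_algebra TYPE('l)"
  shows "normed_conj_algebra TYPE('k)"
proof -
  interpret L: normed_conj_algebra "TYPE('l)" by fact
  have lin: "linear \<phi>" and bij: "bij \<phi>" and one: "\<phi> 1 = 1"
    and mult: "\<And>x y. \<phi> (x * y) = \<phi> x * \<phi> y"
    and conj: "\<And>x. \<phi> (kconj x) = kconj (\<phi> x)"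
    \<comment> \<open>Both equations are oriented from \<open>'k\<close> to \<open>'l\<close>, so
      rewriting with \<open>hom\<close> moves every norm and real part into
      \<open>'l\<close>.\<close>
    and nrm: "\<And>x. norm x = norm (\<phi> x)" and re: "\<And>x. kre x = kre (\<phi> x)"
    using iso by (auto simp: conj_algebra_iso_def)
  have eq_iff: "x = y \<longleftrightarrow> \<phi> x = \<phi> y" for x y
    using bij by (auto dest: bij_is_inj injD)
  note hom = mult conj nrm re one linear_add[OF lin] linear_scale[OF lin] linear_diff[OF lin]
  show ?thesis
  proof (rule normed_conj_algebra.intro)
    show "bilinear ((*) :: 'k \<Rightarrow> 'k \<Rightarrow> 'k)"
      using L.bilinear_mult by (simp add: bilinear_def linear_iff eq_iff hom)
    show "linear (kre :: 'k \<Rightarrow> real)"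
      using L.linear_kre by (simp add: linear_iff hom)
    fix a b c :: 'k
    show "1 * a = a" "a * 1 = a" by (simp_all add: eq_iff hom)
    show "kre (1 :: 'k) = 1" by (simp add: hom)
    show "kre (a * b) = kre (b * a)" by (simp add: hom L.kre_mult_commute)
    show "kre (a * b * c) = kre (a * (b * c))" by (simp add: hom L.kre_mult_assoc)
    show "kconj a = (2 * kre a) *\<^sub>R 1 - a"
      unfolding eq_iff hom by (rule L.kconj_eq)
    show "kconj a * a = (norm a)\<^sup>2 *\<^sub>R 1"
      unfolding eq_iff hom by (rule L.kconj_mult_self)
  qed
qed

lemma is_RCHO_normed_conj_algebra:
  "is_RCHO TYPE('k::conj_algebra) \<Longrightarrow> normed_conj_algebra TYPE('k)"
  unfolding is_RCHO_def is_octonions_def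
  by (elim disjE exE; erule normed_conj_algebra_iso)
    (rule normed_conj_algebra_real normed_conj_algebra_complex
      normed_conj_algebra_quat normed_conj_algebra_oct)+

section \<open>Conjugation, norm and the trace form\<close>

context normed_conj_algebra
begin

lemma mult_distrib [algebra_simps]:
  fixes a b c :: 'k
  shows "(a + b) * c = a * c + b * c" "a * (b + c) = a * b + a * c"
    "(a - b) * c = a * c - b * c" "a * (b - c) = a * b - a * c"
  by (simp_all add: bilinear_ladd[OF bilinear_mult] bilinear_radd[OF bilinear_mult]
      bilinear_lsub[OF bilinear_mult] bilinear_rsub[OF bilinear_mult])

lemma mult_scaleR [simp]:
  fixes a b :: 'k
  shows "(r *\<^sub>R a) * b = r *\<^sub>R (a * b)" "a * (r *\<^sub>R b) = r *\<^sub>R (a * b)"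
  by (simp_all add: bilinear_lmul[OF bilinear_mult] bilinear_rmul[OF bilinear_mult])

lemma mult_zero [simp]: "0 * (a :: 'k) = 0" "(a :: 'k) * 0 = 0"
  by (simp_all add: bilinear_lzero[OF bilinear_mult] bilinear_rzero[OF bilinear_mult])

lemma kre_simps [simp]:
  fixes a b :: 'k
  shows "kre (a + b) = kre a + kre b" "kre (a - b) = kre a - kre b"
    "kre (r *\<^sub>R a) = r * kre a" "kre (0 :: 'k) = 0"
  using linear_kre
  by (simp_all add: linear_add linear_diff linear_scale linear_0)

lemma kre_kconj [simp]: "kre (kconj (a :: 'k)) = kre a"
  by (simp add: kconj_eq)

lemma kconj_kconj [simp]: "kconj (kconj (a :: 'k)) = a"
  by (subst kconj_eq) (simp add: kconj_eq[of a])

lemma kre_kconj_mult_self: "kre (kconj a * (a :: 'k)) = (norm a)\<^sup>2"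
  by (simp add: kconj_mult_self)

text \<open>Conjugation is an involution, so the two squared norms are the real parts of
  \<open>kconj a * a\<close> and \<open>a * kconj a\<close>, which agree by trace
  commutativity.\<close>

lemma norm_kconj [simp]: "norm (kconj (a :: 'k)) = norm a"
proof -
  have "(norm (kconj a))\<^sup>2 = (norm a)\<^sup>2"
    using kre_kconj_mult_self[of a] kre_kconj_mult_self[of "kconj a"] kre_mult_commute[of a] by simp
  then show ?thesis by simp
qed

text \<open>Both sides expand to \<open>2 * kre p * kre a - kre (p * a)\<close>; this is the
  symmetry of the real inner product on the algebra.\<close>

lemma kre_kconj_mult: "kre (kconj p * (a :: 'k)) = kre (kconj a * p)"
  using kre_mult_commute[of p a] by (simp add: kconj_eq algebra_simps)

lemma abs_kre_le_norm: "\<bar>kre (a :: 'k)\<bar> \<le> norm a"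
proof -
  \<comment> \<open>The imaginary part of \<open>a\<close>. It is orthogonal to 1, so Pythagoras
    gives the next equation.\<close>
  define b where "b = a - kre a *\<^sub>R 1"
  have "(norm a)\<^sup>2 = (norm b)\<^sup>2 + (kre a)\<^sup>2"
    unfolding kre_kconj_mult_self[symmetric]
    by (simp add: b_def kconj_eq algebra_simps power2_eq_square)
  then have "\<bar>kre a\<bar>\<^sup>2 \<le> (norm a)\<^sup>2" by simp
  then show ?thesis by (rule power2_le_imp_le) simp
qed

text \<open>Nondegeneracy of the trace form: the test element \<open>kconj a\<close> yields the
  squared norm of \<open>a\<close>.\<close>

lemma eq_0_if_kre_mult:
  assumes "\<And>p. kre (p * (a :: 'k)) = 0"
  shows "a = 0"
  using assms[of "kconj a"] by (simp add: kre_kconj_mult_self)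

end

section \<open>Real Riesz representation\<close>

text \<open>The representing vector minimizes \<open>\<parallel>x\<parallel>\<^sup>2 - 2 f(x)\<close>.\<close>

lemma Riesz_representation:
  fixes f :: "'h::{real_inner, complete_space} \<Rightarrow> real"
  assumes "bounded_linear f"
  obtains y where "\<And>x. f x = inner x y"
proof -
  interpret f: bounded_linear f by fact
  define J where "J x = (norm x)\<^sup>2 - 2 * f x" for x
  obtain B where B: "\<And>x. \<bar>f x\<bar> \<le> norm x * B"
    using f.bounded by auto
  have J_lower: "J x \<ge> - B\<^sup>2" for x
  proof -
    have "0 \<le> (norm x - B)\<^sup>2" by simp
    with B[of x] show ?thesis by (simp add: J_def power2_diff)
  qed
  then have bdd: "bdd_below (range J)" by (auto intro!: bdd_belowI)
  define m where "m = (INF x. J x)"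
  have m_le: "m \<le> J x" for x unfolding m_def using bdd by (simp add: cINF_lower)
  have "\<exists>x. J x < m + 1 / Suc n" for n
  proof -
    have "Inf (range J) < m + 1 / Suc n" unfolding m_def by simp
    then show ?thesis using cInf_lessD[of "range J"] by auto
  qed
  then obtain u where u: "\<And>n. J (u n) < m + 1 / Suc n" by metis
  have par: "(norm (x - z))\<^sup>2 \<le> 2 * ((J x - m) + (J z - m))" for x z
  proof -
    \<comment> \<open>At the midpoint the linear terms of \<open>J\<close> cancel, and the
      parallelogram law leaves half the squared distance. Since \<open>J w\<close> is at least
      \<open>m\<close>, near-minimizers are close to each other.\<close>
    define w where "w = (1/2) *\<^sub>R (x + z)"
    have "J x + J z - 2 * J w = (norm (x - z))\<^sup>2 / 2"
      by (simp add: J_def w_def f.add f.scale power2_norm_eq_inner inner_add inner_diff inner_commute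
          algebra_simps)
    with m_le[of w] show ?thesis by simp
  qed
  have "Cauchy u"
  proof (rule metric_CauchyI)
    fix e :: real assume "e > 0"
    then obtain N where N: "1 / Suc N < e\<^sup>2 / 4"
      using reals_Archimedean[of "e\<^sup>2 / 4"] by (auto simp: field_simps)
    \<comment> \<open>Two excesses below a quarter of the square of \<open>e\<close>, inserted in
      \<open>par\<close>, bound the squared distance by the square of \<open>e\<close>.\<close>
    have close: "J (u n) - m < e\<^sup>2 / 4" if "n \<ge> N" for n
    proof -
      have "1 / Suc n \<le> 1 / Suc N" using that by (simp add: frac_le)
      with u[of n] N show ?thesis by linarith
    qed
    have "dist (u i) (u j) < e" if "i \<ge> N" "j \<ge> N" for i j
    proof -
      have "(norm (u i - u j))\<^sup>2 < e\<^sup>2"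
        using par[of "u i" "u j"] close[OF that(1)] close[OF that(2)] by (simp add: field_simps)
      then show ?thesis using \<open>e > 0\<close> by (simp add: dist_norm power2_less_imp_less)
    qed
    then show "\<exists>N. \<forall>i\<ge>N. \<forall>j\<ge>N. dist (u i) (u j) < e" by blast
  qed
  then obtain y where y: "u \<longlonglongrightarrow> y" by (auto simp: Cauchy_convergent_iff convergent_def)
  have "(\<lambda>n. J (u n)) \<longlonglongrightarrow> J y"
    unfolding J_def by (intro tendsto_intros y f.tendsto)
  moreover have "(\<lambda>n. m + 1 / Suc n) \<longlonglongrightarrow> m + 0"
    by (intro tendsto_intros LIMSEQ_Suc[OF lim_1_over_n])
  ultimately have "J y \<le> m"
    using LIMSEQ_le[of "\<lambda>n. J (u n)" "J y" "\<lambda>n. m + 1 / Suc n" m] u by (auto intro: less_imp_le)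
  have "f x = inner x y" for x
  proof (cases "x = 0")
    case False
    \<comment> \<open>\<open>t\<close> minimizes the quadratic by which \<open>J\<close> changes
      along the line through \<open>y\<close> in direction \<open>x\<close>. The change there is
      negative unless \<open>c = 0\<close>, contradicting minimality of \<open>y\<close>.\<close>
    define c t where "c = inner x y - f x" and "t = - c / (norm x)\<^sup>2"
    have "(norm (y + t *\<^sub>R x))\<^sup>2 = (norm y)\<^sup>2 + 2 * (t * inner x y) + t * (t * (norm x)\<^sup>2)"
      by (simp add: power2_norm_eq_inner inner_add inner_commute)
    then have "J (y + t *\<^sub>R x) = J y + (2 * t * c + t\<^sup>2 * (norm x)\<^sup>2)"
      by (simp add: J_def c_def f.add f.scale algebra_simps power2_eq_square)
    also have "2 * t * c + t\<^sup>2 * (norm x)\<^sup>2 = - c\<^sup>2 / (norm x)\<^sup>2"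
      using False by (simp add: t_def field_simps power2_eq_square)
    finally have "c\<^sup>2 / (norm x)\<^sup>2 \<le> 0"
      using m_le[of "y + t *\<^sub>R x"] \<open>J y \<le> m\<close> by simp
    then have "c = 0" using False by (simp add: divide_le_0_iff)
    then show ?thesis by (simp add: c_def)
  qed (simp add: f.zero)
  then show thesis by (rule that)
qed


section \<open>Linear maps, and access to the Hilbert space axioms\<close>

lemma real_linear_on_UNIV: "real_linear_on UNIV f \<longleftrightarrow> linear f"
  by (auto simp: real_linear_on_def linear_iff)

lemma real_linear_on_diff:
  assumes "real_linear_on S f" "subspace S" "x \<in> S" "y \<in> S"
  shows "f (x - y) = f x - f y"
proof -
  have "f (x + (-1) *\<^sub>R y) = f x + (-1) *\<^sub>R f y"
    using assms subspace_scale[of S y "-1"] unfolding real_linear_on_def by metis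
  then show ?thesis by simp
qed

lemma bounded_linear_if_continuous:
  fixes f :: "'a::real_normed_vector \<Rightarrow> 'b::real_normed_vector"
  assumes "linear f" and cont: "continuous_on UNIV f"
  shows "bounded_linear f"
proof -
  interpret linear f by fact
  obtain d where d: "d > 0" "\<And>x. norm x < d \<Longrightarrow> norm (f x) < 1"
    using cont[unfolded continuous_on_iff, rule_format, of 0 1] by (auto simp: dist_norm zero)
  have "norm (f x) \<le> norm x * (2 / d)" for x
  proof (cases "x = 0")
    case False
    \<comment> \<open>Rescales \<open>x\<close> to norm \<open>d / 2\<close>, inside the ball where
      \<open>f\<close> is bounded by 1.\<close>
    define c where "c = d / (2 * norm x)"
    have "norm (c *\<^sub>R x) < d" using False d(1) by (simp add: c_def)
    from d(2)[OF this] have "c * norm (f x) < 1" using d(1) by (simp add: scale c_def)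
    then show ?thesis using False d(1) by (simp add: c_def field_simps)
  qed (simp add: zero)
  then show ?thesis by (intro bounded_linear_intro add scale)
qed

lemma K_Hilbert_onD:
  assumes "K_Hilbert_on S rip sm ip"
  shows "real_Hilbert_on S rip" "left_module S sm" "real_bilinear_on S S ip"
    "\<And>u v. u \<in> S \<Longrightarrow> v \<in> S \<Longrightarrow> kre (ip u v) = rip u v"
    "\<And>u. u \<in> S \<Longrightarrow> para_linear_on S sm (\<lambda>x. ip x u)"
    "\<And>u v. u \<in> S \<Longrightarrow> v \<in> S \<Longrightarrow> ip u v = kconj (ip v u)"
    "\<And>u. u \<in> S \<Longrightarrow> \<exists>r\<ge>0. ip u u = r *\<^sub>R 1"
    "\<And>u. u \<in> S \<Longrightarrow> ip u u = 0 \<longleftrightarrow> u = 0"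
proof -
  have "real_Hilbert_on S rip" "left_module S sm" "real_bilinear_on S S ip"
    and "\<forall>x\<in>S. \<forall>y\<in>S. kre (ip x y) = rip x y"
    and "\<forall>u\<in>S. para_linear_on S sm (\<lambda>x. ip x u)"
    and "\<forall>u\<in>S. \<forall>v\<in>S. ip u v = kconj (ip v u)"
    and "\<forall>u\<in>S. (\<exists>r\<ge>0. ip u u = r *\<^sub>R 1) \<and> (ip u u = 0 \<longleftrightarrow> u = 0)"
    \<comment> \<open>The conjuncts are split by rules: as a rewrite rule,
      \<open>ip u v = kconj (ip v u)\<close> would apply to its own right side.\<close>
    using assms unfolding K_Hilbert_on_def by - (elim conjE, assumption)+
  note facts = this
  show "real_Hilbert_on S rip" "left_module S sm" "real_bilinear_on S S ip" by (fact facts)+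
  fix u assume u: "u \<in> S"
  show "para_linear_on S sm (\<lambda>x. ip x u)" using facts(5) u by (rule bspec)
  show "\<exists>r\<ge>0. ip u u = r *\<^sub>R 1" "ip u u = 0 \<longleftrightarrow> u = 0" using facts(7) u by simp_all
  fix v assume v: "v \<in> S"
  show "kre (ip u v) = rip u v" "ip u v = kconj (ip v u)"
    by (rule facts(4,6)[rule_format, OF u v])+
qed

section \<open>Transport of structure along a linear map\<close>

context
  fixes S :: "'m::real_vector set" and sm :: "'k::conj_algebra \<Rightarrow> 'm \<Rightarrow> 'm"
    and \<phi> :: "'m \<Rightarrow> 'n::real_vector" and tm :: "'k \<Rightarrow> 'n \<Rightarrow> 'n"
  assumes module: "left_module S sm" and linear: "real_linear_on S \<phi>"
    and smult: "\<And>p x. x \<in> S \<Longrightarrow> \<phi> (sm p x) = tm p (\<phi> x)"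
begin

private lemma smult_mem: "x \<in> S \<Longrightarrow> sm p x \<in> S"
  using module by (simp add: left_module_def)

private lemma subspace_dom: "subspace S"
  using module by (simp add: left_module_def)

text \<open>Oriented so that operations on image points are absorbed into \<phi>; a claim about the
  image then becomes the same claim about \<open>S\<close>.\<close>

private lemma image_add: "x \<in> S \<Longrightarrow> y \<in> S \<Longrightarrow> \<phi> x + \<phi> y = \<phi> (x + y)"
  and image_scaleR: "x \<in> S \<Longrightarrow> c *\<^sub>R \<phi> x = \<phi> (c *\<^sub>R x)"
  using linear by (simp_all add: real_linear_on_def)

private lemma image_diff: "x \<in> S \<Longrightarrow> y \<in> S \<Longrightarrow> \<phi> x - \<phi> y = \<phi> (x - y)"
  using real_linear_on_diff[OF linear subspace_dom] by simp

private lemma image_zero: "\<phi> 0 = 0"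
  using image_scaleR[of 0 0] subspace_0[OF subspace_dom] by simp

private lemmas image_simps = image_add image_scaleR image_diff smult[symmetric] smult_mem
  subspace_add[OF subspace_dom] subspace_scale[OF subspace_dom] subspace_diff[OF subspace_dom]

lemma subspace_image: "subspace (\<phi> ` S)"
  unfolding subspace_def
  using subspace_0[OF subspace_dom] image_zero[symmetric] by (auto simp: image_simps)

lemma left_module_image: "left_module (\<phi> ` S) tm"
  using module subspace_image
  by (auto simp: left_module_def real_bilinear_on_def real_linear_on_def image_simps
      split: if_splits)

lemma real_bilinear_on_image:
  assumes "real_bilinear_on S S b" "\<And>x y. x \<in> S \<Longrightarrow> y \<in> S \<Longrightarrow> b' (\<phi> x) (\<phi> y) = b x y"
  shows "real_bilinear_on (\<phi> ` S) (\<phi> ` S) b'"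
  using assms by (auto simp: real_bilinear_on_def real_linear_on_def image_simps)

lemma real_Hilbert_on_image:
  assumes H: "real_Hilbert_on S rip"
    and rip: "\<And>x y. x \<in> S \<Longrightarrow> y \<in> S \<Longrightarrow> rip' (\<phi> x) (\<phi> y) = rip x y"
  shows "real_Hilbert_on (\<phi> ` S) rip'"
proof -
  have bilin: "real_bilinear_on S S rip" using H by (simp add: real_Hilbert_on_def)
  have complete: "\<forall>v. (\<forall>n. v n \<in> S) \<longrightarrow>
      (\<forall>e>0. \<exists>N. \<forall>m\<ge>N. \<forall>n\<ge>N. sqrt (rip (v m - v n) (v m - v n)) < e) \<longrightarrow>
      (\<exists>l\<in>S. (\<lambda>n. sqrt (rip (v n - l) (v n - l))) \<longlonglongrightarrow> 0)"
    using H unfolding real_Hilbert_on_def by (elim conjE)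
  \<comment> \<open>If \<phi> sends \<open>x\<close> to 0, the values of \<open>rip'\<close> at the
    images of \<open>x\<close> and 0 coincide, so \<open>rip x x = rip 0 0 = 0\<close> and
    \<open>x = 0\<close>. Preservation of the inner product thus carries definiteness to the
    image.\<close>
  have zero_iff: "rip x x = 0 \<longleftrightarrow> \<phi> x = 0" if "x \<in> S" for x
  proof -
    have "rip x x = rip 0 0" if "\<phi> x = 0"
      using rip[OF \<open>x \<in> S\<close> \<open>x \<in> S\<close>] rip[of 0 0] subspace_0[OF subspace_dom]
      by (simp add: that image_zero)
    moreover have "rip y y = 0 \<longleftrightarrow> y = 0" if "y \<in> S" for y
      using H that unfolding real_Hilbert_on_def by blast
    ultimately show ?thesis using that subspace_0[OF subspace_dom] image_zero by metis
  qed
  have "\<exists>l\<in>\<phi> ` S. (\<lambda>n. sqrt (rip' (u n - l) (u n - l))) \<longlonglongrightarrow> 0"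
    if u: "\<And>n. u n \<in> \<phi> ` S"
      and C: "\<forall>e>0. \<exists>N. \<forall>m\<ge>N. \<forall>n\<ge>N. sqrt (rip' (u m - u n) (u m - u n)) < e" for u
  proof -
    \<comment> \<open>Completeness: preimages have the same mutual distances, so they form a Cauchy
      sequence in \<open>S\<close>, and the image of its limit is the limit sought.\<close>
    from u have "\<forall>n. \<exists>x. x \<in> S \<and> u n = \<phi> x" by blast
    then obtain v where v: "\<And>n. v n \<in> S" "\<And>n. u n = \<phi> (v n)" by metis
    have "\<forall>e>0. \<exists>N. \<forall>m\<ge>N. \<forall>n\<ge>N. sqrt (rip (v m - v n) (v m - v n)) < e"
      using C by (simp add: v image_simps rip)
    from complete[THEN spec, of v, THEN mp, THEN mp, OF allI[OF v(1)] this]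
    obtain l where "l \<in> S" "(\<lambda>n. sqrt (rip (v n - l) (v n - l))) \<longlonglongrightarrow> 0" by blast
    then show ?thesis by (intro bexI[of _ "\<phi> l"]) (simp_all add: v image_simps rip)
  qed
  then show ?thesis
    using H subspace_image real_bilinear_on_image[OF bilin rip] zero_iff
    by (simp add: real_Hilbert_on_def rip)
qed

lemma K_Hilbert_on_image:
  assumes H: "K_Hilbert_on S rip sm ip"
    and rip: "\<And>x y. x \<in> S \<Longrightarrow> y \<in> S \<Longrightarrow> rip' (\<phi> x) (\<phi> y) = rip x y"
    and ip: "\<And>x y. x \<in> S \<Longrightarrow> y \<in> S \<Longrightarrow> ip' (\<phi> x) (\<phi> y) = ip x y"
  shows "K_Hilbert_on (\<phi> ` S) rip' tm ip'"
proof -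
  have bilin: "real_bilinear_on S S ip" and Hilbert: "real_Hilbert_on S rip"
    using H by (rule K_Hilbert_onD)+
  have zero_iff: "ip x x = 0 \<longleftrightarrow> \<phi> x = 0" if "x \<in> S" for x
  proof -
    have "ip x x = ip 0 0" if "\<phi> x = 0"
      using ip[OF \<open>x \<in> S\<close> \<open>x \<in> S\<close>] ip[of 0 0] subspace_0[OF subspace_dom]
      by (simp add: that image_zero)
    moreover have "ip y y = 0 \<longleftrightarrow> y = 0" if "y \<in> S" for y
      using K_Hilbert_onD(8)[OF H that] .
    ultimately show ?thesis using that subspace_0[OF subspace_dom] image_zero by metis
  qed
  \<comment> \<open>By \<open>smult\<close> and \<open>ip\<close>, the associators on the image
    equal those on \<open>S\<close>.\<close>
  have "para_linear_on (\<phi> ` S) tm (\<lambda>x. ip' x (\<phi> u))" if "u \<in> S" for u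
  proof -
    have "para_linear_on S sm (\<lambda>x. ip x u)"
      using K_Hilbert_onD(5)[OF H that] .
    then show ?thesis
      using that by (auto simp: para_linear_on_def real_linear_on_def map_assoc_def image_simps ip)
  qed
  moreover have "kre (ip' f g) = rip' f g \<and> ip' f g = kconj (ip' g f)"
    if fg: "f \<in> \<phi> ` S" "g \<in> \<phi> ` S" for f g
  proof -
    obtain x y where xy: "x \<in> S" "y \<in> S" "f = \<phi> x" "g = \<phi> y" using fg by blast
    show ?thesis
      using K_Hilbert_onD(4,6)[OF H xy(1,2)] unfolding xy(3,4) ip[OF xy(1,2)] ip[OF xy(2,1)]
        rip[OF xy(1,2)] by (rule conjI)
  qed
  moreover have "(\<exists>r\<ge>0. ip' f f = r *\<^sub>R 1) \<and> (ip' f f = 0 \<longleftrightarrow> f = 0)"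
    if f: "f \<in> \<phi> ` S" for f
  proof -
    obtain x where x: "x \<in> S" "f = \<phi> x" using f by blast
    show ?thesis
      using K_Hilbert_onD(7)[OF H x(1)] zero_iff[OF x(1)] unfolding x(2) ip[OF x(1) x(1)]
      by (rule conjI)
  qed
  ultimately show ?thesis
    using real_Hilbert_on_image[OF Hilbert rip] left_module_image real_bilinear_on_image[OF bilin ip]
    unfolding K_Hilbert_on_def by (intro conjI ballI) (assumption | blast)+
qed

end

section \<open>Para-linear functionals and the right module structure of the dual\<close>

context normed_conj_algebra
begin

text \<open>Polarization of the square law: expand it at \<open>p + q\<close> and subtract its
  instances at \<open>p\<close> and \<open>q\<close>.\<close>

lemma left_module_alternative:
  fixes sm :: "'k \<Rightarrow> 'm::real_vector \<Rightarrow> 'm"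
  assumes M: "left_module UNIV sm"
  shows "sm p (sm q x) + sm q (sm p x) = sm (p * q + q * p) x"
proof -
  \<comment> \<open>Over the octonions this is the module axiom, otherwise associativity with equal
    scalars; one argument thus serves both branches of \<open>left_module\<close>.\<close>
  have sq: "sm r (sm r x) = sm (r * r) x" for r x
    using M by (auto simp: left_module_def split: if_splits)
  have add: "sm (a + b) x = sm a x + sm b x" "sm a (x + y) = sm a x + sm a y" for a b x y
    using M by (simp_all add: left_module_def real_bilinear_on_def real_linear_on_def)
  show ?thesis
    using sq[of "p + q" x] sq[of p x] sq[of q x] by (simp add: add mult_distrib algebra_simps)
qed

text \<open>\<open>kconj p\<close> is a real combination of 1 and \<open>p\<close>, so only the
  square law is needed to merge the two scalars.\<close>

lemma left_module_kconj:
  fixes sm :: "'k \<Rightarrow> 'm::real_vector \<Rightarrow> 'm"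
  assumes M: "left_module UNIV sm"
  shows "sm (kconj p) (sm p x) = (norm p)\<^sup>2 *\<^sub>R x"
proof -
  have sq: "sm r (sm r x) = sm (r * r) x" for r x
    using M by (auto simp: left_module_def split: if_splits)
  have "linear (\<lambda>a. sm a y)" and one: "sm 1 y = y" for y
    using M by (simp_all add: left_module_def real_bilinear_on_def real_linear_on_UNIV)
  note lin = linear_diff[OF this(1)] linear_scale[OF this(1)]
  have "sm (kconj p) (sm p x) = sm (kconj p * p) x"
    by (simp add: kconj_eq lin one sq mult_distrib)
  then show ?thesis by (simp add: kconj_mult_self lin one)
qed

lemma para_linear_kre:
  fixes sm :: "'k \<Rightarrow> 'm::real_vector \<Rightarrow> 'm"
  assumes "para_linear_on UNIV sm f"
  shows "kre (p * f x) = kre (f (sm p x))"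
  using assms by (simp add: para_linear_on_def map_assoc_def)

text \<open>Para-linearity turns \<open>kre (p * (f x - g x))\<close> into a difference of real
  parts at \<open>sm p x\<close>, which vanishes for every \<open>p\<close>; the trace form is
  nondegenerate.\<close>

lemma para_linear_eqI:
  fixes sm :: "'k \<Rightarrow> 'm::real_vector \<Rightarrow> 'm"
  assumes "para_linear_on UNIV sm f" "para_linear_on UNIV sm g" "\<And>x. kre (f x) = kre (g x)"
  shows "f = g"
proof
  fix x
  have "f x - g x = 0"
    using assms by (intro eq_0_if_kre_mult) (simp add: mult_distrib para_linear_kre)
  then show "f x = g x" by simp
qed

lemma subspace_dual_space:
  fixes sm :: "'k \<Rightarrow> 'h::real_normed_vector \<Rightarrow> 'h"
  shows "subspace (dual_space sm)"
proof -
  have "continuous_on UNIV (0 :: 'h \<Rightarrow> 'k)"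
    by (simp add: zero_fun_def)
  then show ?thesis
    by (auto simp: subspace_def dual_space_def para_linear_on_def real_linear_on_UNIV
        map_assoc_def scaleR_fun_def linear_iff mult_distrib algebra_simps
        intro: continuous_intros)
qed

lemma kre_dual_rmult:
  fixes sm :: "'k \<Rightarrow> 'm::real_vector \<Rightarrow> 'm"
  assumes "para_linear_on UNIV sm f"
  shows "kre (dual_rmult sm f p x) = kre (f (sm p x))"
  using assms kre_mult_commute[of "f x" p]
  by (simp add: dual_rmult_def para_linear_on_def map_assoc_def)

lemma para_linear_dual_rmult:
  fixes sm :: "'k \<Rightarrow> 'm::real_vector \<Rightarrow> 'm"
  assumes M: "left_module UNIV sm" and f: "para_linear_on UNIV sm f"
  shows "para_linear_on UNIV sm (dual_rmult sm f p)"
  unfolding para_linear_on_def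
proof (intro conjI allI ballI)
  have lin: "linear f" "linear (sm q)" for q
    using f M by (simp_all add: para_linear_on_def left_module_def real_bilinear_on_def
        real_linear_on_UNIV)
  note lin_simps = linear_add[OF lin(1)] linear_scale[OF lin(1)] linear_add[OF lin(2)]
    linear_scale[OF lin(2)]
  show "real_linear_on UNIV (dual_rmult sm f p)"
    by (simp add: real_linear_on_def dual_rmult_def map_assoc_def lin_simps mult_distrib
        algebra_simps)
  fix q x
  \<comment> \<open>Here \<open>dual_rmult sm f p x\<close> is expanded as
    \<open>f x * p - f (sm p x) + p * f x\<close>. The trace identities then bring the outer terms
    to \<open>p * q\<close> and \<open>q * p\<close> acting on \<open>f x\<close>.\<close>
  have "kre (q * dual_rmult sm f p x) = kre (q * (f x * p)) - kre (f (sm q (sm p x)))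
      + kre (q * (p * f x))"
    using para_linear_kre[OF f, of q "sm p x"]
    by (simp add: dual_rmult_def map_assoc_def mult_distrib)
  also have "kre (q * (f x * p)) = kre (p * q * f x)"
    using kre_mult_commute[of "q * f x" p] by (simp add: kre_mult_assoc[symmetric])
  also have "kre (q * (p * f x)) = kre (q * p * f x)" by (simp add: kre_mult_assoc)
  also have "kre (p * q * f x) - kre (f (sm q (sm p x))) + kre (q * p * f x) =
      kre (f (sm p (sm q x)))"
  proof -
    \<comment> \<open>The symmetric sum is what alternativity controls: it equals the sum of both
      iterated actions, one of which cancels.\<close>
    have "kre ((p * q + q * p) * f x) = kre (f (sm p (sm q x) + sm q (sm p x)))"
      unfolding left_module_alternative[OF M] by (rule para_linear_kre[OF f])
    then show ?thesis by (simp add: mult_distrib lin_simps)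
  qed
  also have "\<dots> = kre (dual_rmult sm f p (sm q x))" by (rule kre_dual_rmult[OF f, symmetric])
  finally show "kre (map_assoc sm q x (dual_rmult sm f p)) = 0" by (simp add: map_assoc_def)
qed

text \<open>For \<open>a = f(x)\<close> one has \<open>\<bar>a\<bar>\<^sup>2 = Re (kconj a \<cdot> f(x)) = Re f(kconj a \<cdot> x)\<close>.\<close>

lemma para_linear_norm_le:
  fixes sm :: "'k \<Rightarrow> 'h::real_normed_vector \<Rightarrow> 'h"
  assumes f: "para_linear_on UNIV sm f" and norm_sm: "\<And>p x. norm (sm p x) = norm p * norm x"
    and B: "\<And>x. \<bar>kre (f x)\<bar> \<le> B * norm x"
  shows "norm (f x) \<le> B * norm x"
proof -
  define a where "a = f x"
  have "norm a * norm a = kre (f (sm (kconj a) x))"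
    using para_linear_kre[OF f, of "kconj a" x] kre_kconj_mult_self[of a]
    by (simp add: a_def power2_eq_square)
  also have "\<dots> \<le> norm a * (B * norm x)"
    using B[of "sm (kconj a) x"] by (simp add: norm_sm mult_ac)
  finally have "norm a * norm a \<le> norm a * (B * norm x)" .
  \<comment> \<open>Covers the case \<open>norm a = 0\<close>, where no factor can be
    cancelled.\<close>
  moreover have "0 \<le> B * norm x" using B[of x] by linarith
  ultimately show ?thesis
    unfolding a_def[symmetric] by (cases "norm a = 0") simp_all
qed

lemma para_linear_continuousI:
  fixes sm :: "'k \<Rightarrow> 'h::real_normed_vector \<Rightarrow> 'h"
  assumes f: "para_linear_on UNIV sm f" and norm_sm: "\<And>p x. norm (sm p x) = norm p * norm x"
    and B: "\<And>x. \<bar>kre (f x)\<bar> \<le> B * norm x"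
  shows "continuous_on UNIV f"
proof -
  have "linear f" using f by (simp add: para_linear_on_def real_linear_on_UNIV)
  then have "bounded_linear f"
    using para_linear_norm_le[OF assms]
    by (intro bounded_linear_intro[of f B]) (simp_all add: linear_add linear_scale mult.commute)
  then show ?thesis by (rule linear_continuous_on)
qed

lemma dual_space_bounded:
  assumes "f \<in> dual_space sm"
  obtains B where "\<And>x. norm (f x :: 'k) \<le> B * norm x"
proof -
  have "bounded_linear f"
    using assms by (intro bounded_linear_if_continuous)
      (simp_all add: dual_space_def para_linear_on_def real_linear_on_UNIV)
  then show thesis using that by (metis bounded_linear.bounded mult.commute)
qed

text \<open>The real part at \<open>x\<close> is that of \<open>f (sm p x)\<close>, so a bound
  \<open>B\<close> for \<open>f\<close> gives the bound \<open>B * norm p\<close>, and bounded real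
  parts suffice for continuity.\<close>

lemma dual_rmult_in_dual_space:
  fixes sm :: "'k \<Rightarrow> 'h::real_normed_vector \<Rightarrow> 'h"
  assumes M: "left_module UNIV sm" and norm_sm: "\<And>p x. norm (sm p x) = norm p * norm x"
    and f: "f \<in> dual_space sm"
  shows "dual_rmult sm f p \<in> dual_space sm"
proof -
  have pf: "para_linear_on UNIV sm f" using f by (simp add: dual_space_def)
  note pl = para_linear_dual_rmult[OF M pf, of p]
  obtain B where B: "\<And>x. norm (f x) \<le> B * norm x" using dual_space_bounded[OF f] by blast
  have "\<bar>kre (dual_rmult sm f p x)\<bar> \<le> B * norm p * norm x" for x
    using abs_kre_le_norm[of "f (sm p x)"] B[of "sm p x"]
    by (simp add: kre_dual_rmult[OF pf] norm_sm mult.assoc)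
  from para_linear_continuousI[OF pl norm_sm this] pl show ?thesis by (simp add: dual_space_def)
qed

lemma right_module_dual_space:
  fixes sm :: "'k \<Rightarrow> 'h::real_normed_vector \<Rightarrow> 'h"
  assumes M: "left_module UNIV sm" and norm_sm: "\<And>p x. norm (sm p x) = norm p * norm x"
  shows "right_module (dual_space sm) (dual_rmult sm)"
proof -
  note mem = dual_rmult_in_dual_space[OF assms]
  have lin: "linear (\<lambda>p. sm p x)" and one: "sm 1 x = x" for x
    using M by (simp_all add: left_module_def real_bilinear_on_def real_linear_on_UNIV)
  have lin_f: "linear f" if "f \<in> dual_space sm" for f
    using that by (simp add: dual_space_def para_linear_on_def real_linear_on_UNIV)
  have "real_linear_on UNIV (dual_rmult sm f)" if "f \<in> dual_space sm" for f
    by (auto simp: real_linear_on_def dual_rmult_def map_assoc_def fun_eq_iff scaleR_fun_def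
        linear_add[OF lin] linear_scale[OF lin] linear_add[OF lin_f[OF that]]
        linear_scale[OF lin_f[OF that]] mult_distrib algebra_simps)
  moreover have "real_linear_on (dual_space sm) (\<lambda>f. dual_rmult sm f p)" for p
    by (auto simp: real_linear_on_def dual_rmult_def map_assoc_def fun_eq_iff scaleR_fun_def
        mult_distrib algebra_simps)
  ultimately have bilin: "real_bilinear_on (dual_space sm) UNIV (dual_rmult sm)"
    by (simp add: real_bilinear_on_def)
  \<comment> \<open>Stated for a single pair \<open>p\<close>, \<open>q\<close> whose actions
    compose on \<open>H\<close>, so it applies to equal scalars over the octonions and to all pairs
    otherwise. On real parts both sides become \<open>kre (f (sm p (sm q x)))\<close>.\<close>
  have assoc: "dual_rmult sm (dual_rmult sm f p) q = dual_rmult sm f (p * q)"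
    if f: "f \<in> dual_space sm" and pq: "\<And>x. sm p (sm q x) = sm (p * q) x" for f p q
  proof (rule para_linear_eqI[of sm])
    have pl: "para_linear_on UNIV sm g" if "g \<in> dual_space sm" for g
      using that by (simp add: dual_space_def)
    show "para_linear_on UNIV sm (dual_rmult sm (dual_rmult sm f p) q)"
      "para_linear_on UNIV sm (dual_rmult sm f (p * q))"
      by (intro pl mem f)+
    show "kre (dual_rmult sm (dual_rmult sm f p) q x) = kre (dual_rmult sm f (p * q) x)" for x
      by (simp add: kre_dual_rmult pl mem f pq)
  qed
  have "dual_rmult sm f 1 = f" for f :: "'h \<Rightarrow> 'k"
    by (simp add: dual_rmult_def map_assoc_def one)
  then show ?thesis
    using M subspace_dual_space[of sm] mem bilin assoc
    by (auto simp: right_module_def left_module_def)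
qed

section \<open>The map from a Hilbert space to its dual\<close>

context
  fixes sm :: "'k \<Rightarrow> 'h::real_inner \<Rightarrow> 'h" and ip :: "'h \<Rightarrow> 'h \<Rightarrow> 'k"
  assumes H: "K_Hilbert_on UNIV inner sm ip"
begin

lemmas K_Hilbert_module = K_Hilbert_onD(2)[OF H]
  and kre_ip = K_Hilbert_onD(4)[OF H UNIV_I UNIV_I]
  and para_linear_ip = K_Hilbert_onD(5)[OF H UNIV_I]
  and ip_kconj = K_Hilbert_onD(6)[OF H UNIV_I UNIV_I]

lemma linear_ip: "linear (ip x)"
  using K_Hilbert_onD(3)[OF H] by (simp add: real_bilinear_on_def real_linear_on_UNIV)

text \<open>The adjoint of \<open>sm p\<close> is \<open>sm (kconj p)\<close>: take the scalar out
  of the first slot, reverse the product by conjugation, and put it back on the other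
  vector.\<close>

lemma inner_smult: "inner (sm p x) y = inner x (sm (kconj p) y)"
proof -
  have "inner (sm p x) y = kre (p * ip x y)"
    using para_linear_kre[OF para_linear_ip] by (simp add: kre_ip)
  also have "\<dots> = kre (kconj (ip x y) * kconj p)"
    using kre_kconj_mult[of "kconj p"] by simp
  also have "\<dots> = kre (kconj p * ip y x)"
    using kre_mult_commute ip_kconj[of y x] by simp
  also have "\<dots> = inner x (sm (kconj p) y)"
    using para_linear_kre[OF para_linear_ip] by (simp add: kre_ip inner_commute)
  finally show ?thesis .
qed

text \<open>Moving one scalar across by \<open>inner_smult\<close> produces
  \<open>sm (kconj p) (sm p x)\<close>, a real multiple of \<open>x\<close>. This supplies the norm
  hypothesis of the dual space lemmas.\<close>

lemma norm_smult: "norm (sm p x) = norm p * norm x"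
proof -
  have "(norm (sm p x))\<^sup>2 = (norm p * norm x)\<^sup>2"
    unfolding power2_norm_eq_inner[of "sm p x"] inner_smult left_module_kconj[OF K_Hilbert_module]
    by (simp add: dot_square_norm power_mult_distrib)
  then show ?thesis by (simp add: power2_eq_iff_nonneg)
qed

lemma ip_in_dual_space: "(\<lambda>x. ip x y) \<in> dual_space sm"
proof -
  have "\<bar>kre (ip x y)\<bar> \<le> norm y * norm x" for x
    using Cauchy_Schwarz_ineq2[of x y] by (simp add: kre_ip mult.commute)
  from para_linear_continuousI[OF para_linear_ip norm_smult this] para_linear_ip
  show ?thesis by (simp add: dual_space_def)
qed

text \<open>On real parts this is the adjoint formula \<open>inner_smult\<close>, which is also
  where the conjugate in \<open>opp_smult\<close> comes from.\<close>

lemma ip_smult_right: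
  "(\<lambda>x. ip x (sm p y)) = opp_smult (dual_rmult sm) p (\<lambda>x. ip x y)"
proof (rule para_linear_eqI[of sm])
  show "para_linear_on UNIV sm (opp_smult (dual_rmult sm) p (\<lambda>x. ip x y))"
    by (simp add: opp_smult_def para_linear_dual_rmult K_Hilbert_module para_linear_ip)
  show "kre (ip x (sm p y)) = kre (opp_smult (dual_rmult sm) p (\<lambda>x. ip x y) x)" for x
    by (simp add: opp_smult_def kre_dual_rmult[OF para_linear_ip] kre_ip inner_smult)
qed (rule para_linear_ip)

lemma inj_ip: "inj (\<lambda>y x. ip x y)"
proof (rule injI)
  fix y z assume "(\<lambda>x. ip x y) = (\<lambda>x. ip x z)"
  then have "inner x y = inner x z" for x by (metis kre_ip)
  then show "y = z" by (metis vector_eq_ldot)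
qed

end

lemma dual_space_eq_range_ip:
  fixes sm :: "'k \<Rightarrow> 'h::{real_inner, complete_space} \<Rightarrow> 'h"
  assumes H: "K_Hilbert_on UNIV inner sm ip"
  shows "dual_space sm = range (\<lambda>y x. ip x y)"
proof (intro equalityI subsetI)
  fix f assume f: "f \<in> dual_space sm"
  then have pf: "para_linear_on UNIV sm f" and "linear f"
    by (simp_all add: dual_space_def para_linear_on_def real_linear_on_UNIV)
  obtain B where "\<And>x. norm (f x) \<le> B * norm x" using dual_space_bounded[OF f] by blast
  then have "\<bar>kre (f x)\<bar> \<le> norm x * B" for x
    using abs_kre_le_norm[of "f x"] by (metis mult.commute order_trans)
  then have "bounded_linear (\<lambda>x. kre (f x))"
    using \<open>linear f\<close> by (intro bounded_linear_intro[of _ B]) (simp_all add: linear_add linear_scale)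
  then obtain y where "\<And>x. kre (f x) = inner x y" using Riesz_representation by blast
  \<comment> \<open>Riesz matches only the real parts; para-linearity of both sides extends this to
    all components.\<close>
  then have "f = (\<lambda>x. ip x y)"
    by (intro para_linear_eqI[OF pf para_linear_ip[OF H]]) (simp add: kre_ip[OF H])
  then show "f \<in> range (\<lambda>y x. ip x y)" by blast
qed (auto simp: ip_in_dual_space[OF H])

end

theorem theorem1p3:
  fixes sm :: "'k::conj_algebra \<Rightarrow> 'h::{real_inner, complete_space} \<Rightarrow> 'h"
    and ip :: "'h \<Rightarrow> 'h \<Rightarrow> 'k"
  assumes "is_RCHO TYPE('k)"
    and "K_Hilbert_on UNIV inner sm ip"
  shows "let \<tau> = (\<lambda>y x. ip x y);
             dual_sm = opp_smult (dual_rmult sm);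
             dual_ip = (\<lambda>f g. ip (inv \<tau> f) (inv \<tau> g));
             dual_rip = (\<lambda>f g. kre (dual_ip f g))
         in right_module (dual_space sm) (dual_rmult sm) \<and>
            (\<forall>y. \<tau> y \<in> dual_space sm) \<and>
            left_module_iso UNIV sm (dual_space sm) dual_sm \<tau> \<and>
            K_Hilbert_on (dual_space sm) dual_rip dual_sm dual_ip \<and>
            K_Hilbert_iso UNIV inner sm ip (dual_space sm) dual_rip dual_sm dual_ip \<tau>"
proof -
  interpret normed_conj_algebra "TYPE('k)"
    using assms(1) by (rule is_RCHO_normed_conj_algebra)
  note H = assms(2)
  define \<tau> where "\<tau> = (\<lambda>y x. ip x y)"
  define dual_sm where "dual_sm = opp_smult (dual_rmult sm)"
  define dual_ip where "dual_ip = (\<lambda>f g. ip (inv \<tau> f) (inv \<tau> g))"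
  define dual_rip where "dual_rip = (\<lambda>f g. kre (dual_ip f g))"
  note M = K_Hilbert_module[OF H]
  have inj: "inj \<tau>" unfolding \<tau>_def by (rule inj_ip[OF H])
  have range: "dual_space sm = range \<tau>" unfolding \<tau>_def by (rule dual_space_eq_range_ip[OF H])
  have lin: "real_linear_on UNIV \<tau>"
    by (simp add: real_linear_on_def \<tau>_def fun_eq_iff scaleR_fun_def
        linear_add[OF linear_ip[OF H]] linear_scale[OF linear_ip[OF H]])
  have smult: "\<tau> (sm p x) = dual_sm p (\<tau> x)" for p x
    unfolding \<tau>_def dual_sm_def by (rule ip_smult_right[OF H])
  \<comment> \<open>Injectivity cancels \<open>inv \<tau>\<close>, so \<tau> preserves both inner
    products and the transport lemmas apply.\<close>
  have dual_ip: "dual_ip (\<tau> x) (\<tau> y) = ip x y" for x y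
    by (simp add: dual_ip_def inj)
  have dual_rip: "dual_rip (\<tau> x) (\<tau> y) = inner x y" for x y
    by (simp add: dual_rip_def dual_ip kre_ip[OF H])
  \<comment> \<open>The dual is the image of \<tau>, so the left module axioms for
    \<open>dual_sm\<close> are transported from \<open>H\<close>; the right module axioms come from
    \<open>right_module_dual_space\<close>.\<close>
  have iso: "left_module_iso UNIV sm (dual_space sm) dual_sm \<tau>"
    using M left_module_image[OF M lin, of dual_sm] lin inj smult
    by (simp add: left_module_iso_def range bij_betw_def)
  have Hilbert: "K_Hilbert_on (dual_space sm) dual_rip dual_sm dual_ip"
    unfolding range by (rule K_Hilbert_on_image[OF M lin _ H]) (rule smult dual_rip dual_ip)+
  have "K_Hilbert_iso UNIV inner sm ip (dual_space sm) dual_rip dual_sm dual_ip \<tau>"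
    using H Hilbert iso dual_ip by (simp add: K_Hilbert_iso_def)
  moreover have "\<forall>y. \<tau> y \<in> dual_space sm" by (simp add: range)
  ultimately show ?thesis
    using right_module_dual_space[OF M norm_smult[OF H]] iso Hilbert
    unfolding Let_def dual_rip_def dual_ip_def dual_sm_def \<tau>_def by (intro conjI)
qed

end
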